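(* Let $\mathcal I=(t,m,n,\mathcal X,\mathcal X^{(S)},R)$ be an instance of the ICCSI problem over $\mathbb F_q$ and let $N=\max\{n-d_i:i\in[m]\}$. Let $m'$ be the number of distinct equivalence classes of $[m]$ under the relation $i\equiv j$ if and only if $\mathcal X^{(i)}=\mathcal X^{(j)}$. Suppose that $q>m'$. If the entries of a matrix $L\in\mathbb F_q^{N\times d_S}$ are chosen (independently and) uniformly at random in $\mathbb F_q$, then the probability that $L$ represents an $\mathbb F_q$-linear $\mathcal I$-IC is at least $(1-m'/q)^{Nd_S}$.
   Context: Notation: $q$ is a prime power, $\mathbb F_q$ the field with $q$ elements, $[m]=\{1,\dots,m\}$. For a matrix $A$, $A_i$ is its $i$-th row and $\langle A\rangle$ its row space. Instance: an instance $\mathcal I=(t,m,n,\mathcal X,\mathcal X^{(S)},R)$ of the Index Coding with Coded Side Information (ICCSI) problem consists of positive integers $t,m,n$; subspaces $\mathcal X^{(S)}$ and $\mathcal X^{(i)}$ ($i\in[m]$) of $\mathbb F_q^n$ of dimensions $d_S$ and $d_i$; $\mathcal X=\{A\in\mathbb F_q^{m\times n}:A_i\in\mathcal X^{(i)},\ i\in[m]\}$; and a matrix $R\in\mathbb F_q^{m\times n}$ with rows $R_i\in\mathcal X^{(S)}\setminus\mathcal X^{(i)}$. Fix matrices $V^{(S)}\in\mathbb F_q^{d_S\times n}$ and $V^{(i)}\in\mathbb F_q^{d_i\times n}$ with $\langle V^{(S)}\rangle=\mathcal X^{(S)}$, $\langle V^{(i)}\rangle=\mathcal X^{(i)}$.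 Index codes: a map $E:\mathbb F_q^{n\times t}\to\mathbb F_q^{N\times t}$ is an $\mathcal I$-IC of length $N$ if for each $i\in[m]$ there is a decoding map $D_i:\mathbb F_q^{N\times t}\times\mathbb F_q^{d_i\times t}\to\mathbb F_q^t$ with $D_i(E(X),V^{(i)}X)=R_iX$ for all $X\in\mathbb F_q^{n\times t}$. It is $\mathbb F_q$-linear if $E(X)=LV^{(S)}X$ for some $L\in\mathbb F_q^{N\times d_S}$; then $L$ is said to represent $E$. *)

theory Defs
  imports
    "HOL-Probability.Product_PMF"
    "Jordan_Normal_Form.VS_Connect"
begin

text \<open>
  The field with \<open>q\<close> elements is a type \<open>'a :: {field, finite}\<close> with \<open>q = CARD('a)\<close>.
  Matrices are 0-indexed, so the index set \<open>[m]\<close> becomes \<open>{0..<m}\<close>.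
\<close>

abbreviation sub_space :: "nat \<Rightarrow> 'a :: field vec set \<Rightarrow> bool" where
  "sub_space n W \<equiv> VectorSpace.subspace class_ring W (module_vec TYPE('a) n)"

definition sub_dim :: "nat \<Rightarrow> 'a :: field vec set \<Rightarrow> nat" where
  "sub_dim n W = vectorspace.dim class_ring ((module_vec TYPE('a) n)\<lparr>carrier := W\<rparr>)"

text \<open>
  \<open>cached I\<close> is the set of matrices \<open>\<X>\<close>, \<open>side I i\<close> is \<open>\<X>\<^sup>(\<^sup>i\<^sup>)\<close> and \<open>sender I\<close> is \<open>\<X>\<^sup>(\<^sup>S\<^sup>)\<close>;
  the values \<open>side I i\<close> for \<open>i \<ge> m\<close> are irrelevant.
\<close>

record 'a iccsi =
  blk :: nat
  users :: nat
  msgs :: nat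
  cached :: "'a mat set"
  side :: "nat \<Rightarrow> 'a vec set"
  sender :: "'a vec set"
  request :: "'a mat"

definition iccsi_instance :: "'a :: {field, finite} iccsi \<Rightarrow> bool" where
  "iccsi_instance I \<longleftrightarrow>
     blk I > 0 \<and> users I > 0 \<and> msgs I > 0 \<and>
     sub_space (msgs I) (sender I) \<and>
     (\<forall>i<users I. sub_space (msgs I) (side I i)) \<and>
     cached I = {A \<in> carrier_mat (users I) (msgs I). \<forall>i<users I. row A i \<in> side I i} \<and>
     request I \<in> carrier_mat (users I) (msgs I) \<and>
     (\<forall>i<users I. row (request I) i \<in> sender I - side I i)"

definition d_sender :: "'a :: field iccsi \<Rightarrow> nat" where
  "d_sender I = sub_dim (msgs I) (sender I)"

definition d_side :: "'a :: field iccsi \<Rightarrow> nat \<Rightarrow> nat" where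
  "d_side I i = sub_dim (msgs I) (side I i)"

definition generates :: "nat \<Rightarrow> 'a :: field mat \<Rightarrow> 'a vec set \<Rightarrow> bool" where
  "generates n V W \<longleftrightarrow>
     V \<in> carrier_mat (sub_dim n W) n \<and> vec_space.row_space n V = W"

definition is_IC ::
  "'a :: {field, finite} iccsi \<Rightarrow> (nat \<Rightarrow> 'a mat) \<Rightarrow> nat \<Rightarrow> ('a mat \<Rightarrow> 'a mat) \<Rightarrow> bool" where
  "is_IC I V N E \<longleftrightarrow>
     E \<in> carrier_mat (msgs I) (blk I) \<rightarrow> carrier_mat N (blk I) \<and>
     (\<forall>i<users I.
        \<exists>D \<in> carrier_mat N (blk I) \<times> carrier_mat (d_side I i) (blk I) \<rightarrow> carrier_vec (blk I).
          \<forall>X \<in> carrier_mat (msgs I) (blk I). D (E X, V i * X) = row (request I * X) i)"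

definition represents ::
  "'a :: {field, finite} iccsi \<Rightarrow> 'a mat \<Rightarrow> nat \<Rightarrow> 'a mat \<Rightarrow> ('a mat \<Rightarrow> 'a mat) \<Rightarrow> bool" where
  "represents I VS N L E \<longleftrightarrow>
     L \<in> carrier_mat N (d_sender I) \<and>
     (\<forall>X \<in> carrier_mat (msgs I) (blk I). E X = L * VS * X)"

definition represents_linear_IC ::
  "'a :: {field, finite} iccsi \<Rightarrow> 'a mat \<Rightarrow> (nat \<Rightarrow> 'a mat) \<Rightarrow> nat \<Rightarrow> 'a mat \<Rightarrow> bool" where
  "represents_linear_IC I VS V N L \<longleftrightarrow> (\<exists>E. is_IC I V N E \<and> represents I VS N L E)"

definition max_codim :: "'a :: field iccsi \<Rightarrow> nat" where
  "max_codim I = Max {msgs I - d_side I i | i. i < users I}"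

definition side_equiv :: "'a iccsi \<Rightarrow> (nat \<times> nat) set" where
  "side_equiv I = {(i, j). i < users I \<and> j < users I \<and> side I i = side I j}"

definition num_side_classes :: "'a iccsi \<Rightarrow> nat" where
  "num_side_classes I = card ({0..<users I} // side_equiv I)"

text \<open>Independent entries, each uniform on the field.\<close>

definition random_mat :: "nat \<Rightarrow> nat \<Rightarrow> 'a :: {field, finite} mat pmf" where
  "random_mat r c =
     map_pmf (mat r c) (Pi_pmf ({0..<r} \<times> {0..<c}) 0 (\<lambda>_. pmf_of_set UNIV))"

end

theory Submission
  imports Defs
begin

text \<open>
  \<open>L\<close> represents an index code as soon as the rows of \<open>L V\<^sup>(\<^sup>S\<^sup>)\<close> span \<open>\<X>\<^sup>(\<^sup>S\<^sup>)\<close> modulo each side space \<open>U\<close>.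
  Writing the rows of \<open>V\<^sup>(\<^sup>S\<^sup>)\<close> modulo \<open>U\<close> in coordinates \<open>W\<close> with \<open>k \<le> n - dim U \<le> N\<close> columns, it
  suffices that the leading \<open>k \<times> k\<close> minor of \<open>L W\<close> is nonzero. This minor is not identically zero
  and is affine in each single entry of \<open>L\<close>, so along any coordinate line through a good \<open>L\<close>
  there is at most one bad value. Choosing the entries one after the other, each of the
  \<open>m'\<close> distinct side spaces excludes at most one value of the current entry, and so a proportion
  of at least \<open>1 - m'/q\<close> of the values keeps all conditions satisfiable.
\<close>

section \<open>Uniform random functions on a finite index set\<close>

lemma measure_bind_pmf_of_set:
  assumes "S \<noteq> {}" "finite S"
  shows "measure_pmf.prob (bind_pmf (pmf_of_set S) f) X = (\<Sum>c\<in>S. measure_pmf.prob (f c) X) / card S"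
proof -
  have "emeasure (bind_pmf (pmf_of_set S) f) X = (\<Sum>c\<in>S. ennreal (measure_pmf.prob (f c) X)) / card S"
    using assms by (simp only: emeasure_bind_pmf) (simp add: nn_integral_pmf_of_set measure_pmf.emeasure_eq_measure)
  also have "\<dots> = ennreal ((\<Sum>c\<in>S. measure_pmf.prob (f c) X) / card S)"
    using assms by (simp add: divide_ennreal sum_nonneg card_gt_0_iff ennreal_of_nat_eq_real_of_nat)
  finally show ?thesis
    by (simp add: measure_pmf.emeasure_eq_measure sum_nonneg)
qed

text \<open>A bound of Schwartz-Zippel type, where degree at most one in each variable is weakened
  to: on a coordinate line through a good point at most one value is bad. The induction exposes the
  entry at the new index first. Each condition may have its own witness; off \<open>A\<close> it
  takes the default \<open>d\<close>, as the samples of \<open>Pi_pmf\<close> do.\<close>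

lemma prob_Pi_pmf_uniform_ge:
  fixes G :: "'k \<Rightarrow> ('b \<Rightarrow> 'a :: finite) \<Rightarrow> bool"
  assumes "finite A" and K: "finite K" "card K \<le> CARD('a)"
    and "\<And>i. i \<in> K \<Longrightarrow> \<exists>x. (\<forall>j. j \<notin> A \<longrightarrow> x j = d) \<and> G i x"
    and "\<And>i x j. i \<in> K \<Longrightarrow> j \<in> A \<Longrightarrow> G i x \<Longrightarrow> card {c. \<not> G i (x(j := c))} \<le> 1"
  shows "measure_pmf.prob (Pi_pmf A d (\<lambda>_. pmf_of_set UNIV)) {x. \<forall>i\<in>K. G i x}
           \<ge> (1 - real (card K) / real CARD('a)) ^ card A"
  using assms(1,4,5)
proof (induction A arbitrary: G rule: finite_induct)
  case empty
  have "G i (\<lambda>_. d)" if i: "i \<in> K" for i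
  proof -
    obtain x where "\<forall>j. x j = d" "G i x" using empty(1)[OF i] by auto
    moreover from this have "x = (\<lambda>_. d)" by auto
    ultimately show ?thesis by simp
  qed
  then show ?case by (simp add: measure_return_pmf)
next
  case (insert a A)
  let ?q = "real CARD('a)" and ?k = "real (card K)"
  let ?P = "Pi_pmf A d (\<lambda>_. pmf_of_set (UNIV :: 'a set))"
  define p where "p = (1 - ?k / ?q) ^ card A"
  have p0: "p \<ge> 0" unfolding p_def using K by simp
  have "\<exists>x. (\<forall>j. j \<notin> insert a A \<longrightarrow> x j = d) \<and> G i x" if "i \<in> K" for i
    using insert.prems(1)[OF that] .
  then obtain x where x: "\<And>i j. i \<in> K \<Longrightarrow> j \<notin> insert a A \<Longrightarrow> x i j = d"
    "\<And>i. i \<in> K \<Longrightarrow> G i (x i)" by metis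
  \<comment> \<open>Condition \<open>i\<close> is tested only on the line through its own witness,
    so it contributes at most one bad value. Any other value at \<open>a\<close> leaves every
    condition satisfiable, though not yet by a common point.\<close>
  define bad where "bad = (\<Union>i\<in>K. {c. \<not> G i ((x i)(a := c))})"
  have "card bad \<le> (\<Sum>i\<in>K. card {c. \<not> G i ((x i)(a := c))})"
    unfolding bad_def by (rule card_UN_le[OF K(1)])
  also have "\<dots> \<le> (\<Sum>i\<in>K. 1)"
    by (intro sum_mono insert.prems(2)) (auto simp: x)
  finally have bad: "card bad \<le> card K" by simp
  have slice: "p \<le> measure_pmf.prob ?P {f. \<forall>i\<in>K. G i (f(a := c))}" if c: "c \<notin> bad" for c
    unfolding p_def
  proof (rule insert.IH)
    fix i assume i: "i \<in> K"
    show "\<exists>y. (\<forall>j. j \<notin> A \<longrightarrow> y j = d) \<and> G i (y(a := c))"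
      \<comment> \<open>In the slice \<open>a\<close> is no longer a variable, so the witness must
        be \<open>d\<close> there; the slice overwrites this value by \<open>c\<close>.\<close>
      by (rule exI[of _ "(x i)(a := d)"]) (use c i x(1)[OF i] in \<open>auto simp: bad_def\<close>)
  next
    fix i f j assume i: "i \<in> K" "j \<in> A" "G i (f(a := c))"
    \<comment> \<open>As \<open>a\<close> is not in \<open>A\<close>, the two updates commute, and a
      line in the slice is a line of the full space through a good point.\<close>
    then have "f(j := c', a := c) = f(a := c, j := c')" for c'
      using insert.hyps by (auto simp: fun_upd_twist)
    then show "card {c'. \<not> G i (f(j := c', a := c))} \<le> 1"
      using insert.prems(2)[of i j "f(a := c)"] i by (simp only: insert_iff simp_thms)
  qed
  have "(?q - ?k) * p \<le> real (card (- bad)) * p"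
    using bad K(2) p0 by (intro mult_right_mono) (auto simp: Compl_eq_Diff_UNIV card_Diff_subset of_nat_diff card_mono)
  also have "\<dots> = (\<Sum>c\<in>-bad. p)" by simp
  also have "\<dots> \<le> (\<Sum>c\<in>-bad. measure_pmf.prob ?P {f. \<forall>i\<in>K. G i (f(a := c))})"
    by (intro sum_mono slice) auto
  also have "\<dots> \<le> (\<Sum>c\<in>UNIV. measure_pmf.prob ?P {f. \<forall>i\<in>K. G i (f(a := c))})"
    by (intro sum_mono2) auto
  finally have *: "(?q - ?k) * p \<le> (\<Sum>c\<in>UNIV. measure_pmf.prob ?P {f. \<forall>i\<in>K. G i (f(a := c))})" .
  have "measure_pmf.prob (Pi_pmf (insert a A) d (\<lambda>_. pmf_of_set UNIV)) {x. \<forall>i\<in>K. G i x}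
      = measure_pmf.prob (bind_pmf (pmf_of_set UNIV) (\<lambda>c. map_pmf (\<lambda>f. f(a := c)) ?P)) {x. \<forall>i\<in>K. G i x}"
    using insert.hyps by (simp add: Pi_pmf_insert' map_pmf_def)
  also have "\<dots> = (\<Sum>c\<in>UNIV. measure_pmf.prob ?P {f. \<forall>i\<in>K. G i (f(a := c))}) / ?q"
    by (subst measure_bind_pmf_of_set) (auto simp: vimage_def)
  finally show ?case
    using divide_right_mono[OF *, of ?q] insert.hyps by (simp add: p_def diff_divide_distrib algebra_simps)
qed

text \<open>The classes are the fibres of \<open>f\<close>, and fibres over distinct points of the
  image are distinct. With \<open>f\<close> the side space of a user, this counts the distinct side
  spaces.\<close>

lemma card_quotient_kernel:
  "card (A // {(i, j). i \<in> A \<and> j \<in> A \<and> f i = f j}) = card (f ` A)"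
proof -
  let ?g = "\<lambda>y. {i \<in> A. f i = y}"
  have "A // {(i, j). i \<in> A \<and> j \<in> A \<and> f i = f j} = (\<lambda>x. ?g (f x)) ` A"
    unfolding quotient_def UNION_singleton_eq_range by (rule image_cong) auto
  then have "A // {(i, j). i \<in> A \<and> j \<in> A \<and> f i = f j} = ?g ` f ` A"
    by (simp only: image_image)
  moreover have "inj_on ?g (f ` A)" by (rule inj_onI) blast
  ultimately show ?thesis by (simp add: card_image)
qed

section \<open>Dependence of a minor on a single entry\<close>

text \<open>The function \<open>x\<close> holds the entries of a matrix that is multiplied by
  \<open>W\<close>. Changing the entry at \<open>(r, l)\<close> affects row \<open>r\<close> of the
  product only, and each entry of that row is affine in \<open>c\<close>; Laplace expansion along
  row \<open>r\<close> gives the claim.\<close>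

lemma det_update_entry_affine:
  fixes W :: "'a :: field mat"
  shows "\<exists>\<alpha> \<beta>. \<forall>c. det (mat k k (\<lambda>(t, t'). \<Sum>s<d. (x((r, l) := c)) (t, s) * W $$ (s, t'))) = \<alpha> + \<beta> * c"
proof (cases "r < k \<and> l < d")
  case True
  define M where "M c = mat k k (\<lambda>(t, t'). \<Sum>s<d. (x((r, l) := c)) (t, s) * W $$ (s, t'))" for c
  have M[simp]: "M c \<in> carrier_mat k k" for c by (simp add: M_def)
  have entry: "M c $$ (r, j) = (\<Sum>s\<in>{..<d} - {l}. x (r, s) * W $$ (s, j)) + c * W $$ (l, j)"
    if "j < k" for c j
    using True that by (simp add: M_def sum.remove[of "{..<d}" l] algebra_simps)
  \<comment> \<open>Deleting row \<open>r\<close> removes every occurrence of \<open>c\<close>, so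
    the cofactors are constants.\<close>
  have del: "mat_delete (M c) r j = mat_delete (M 0) r j" for c j
    by (rule eq_matI) (auto simp: mat_delete_def M_def intro!: sum.cong)
  then have cof: "cofactor (M c) r j = cofactor (M 0) r j" for c j
    unfolding cofactor_def by (simp only: del[of c])
  define \<gamma> where "\<gamma> = cofactor (M 0) r"
  have "det (M c) = (\<Sum>j<k. (\<Sum>s\<in>{..<d} - {l}. x (r, s) * W $$ (s, j)) * \<gamma> j)
      + (\<Sum>j<k. W $$ (l, j) * \<gamma> j) * c" for c
  proof -
    have "det (M c) = (\<Sum>j<k. M c $$ (r, j) * cofactor (M c) r j)"
      using True by (intro laplace_expansion_row) simp_all
    also have "\<dots> = (\<Sum>j<k. (\<Sum>s\<in>{..<d} - {l}. x (r, s) * W $$ (s, j)) * \<gamma> j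
        + W $$ (l, j) * \<gamma> j * c)"
      by (intro sum.cong) (simp_all only: cof[of c] \<gamma>_def[symmetric], simp_all add: entry algebra_simps)
    finally show ?thesis by (simp add: sum.distrib sum_distrib_right)
  qed
  then show ?thesis unfolding M_def by blast
next
  case False
  \<comment> \<open>Outside the window the changed entry does not occur in the minor, so the slope
    is 0.\<close>
  have const: "mat k k (\<lambda>(t, t'). \<Sum>s<d. (x((r, l) := c)) (t, s) * W $$ (s, t'))
      = mat k k (\<lambda>(t, t'). \<Sum>s<d. x (t, s) * W $$ (s, t'))" for c
    by (rule eq_matI) (use False in \<open>auto intro!: sum.cong\<close>)
  show ?thesis
    by (rule exI, rule exI[of _ 0], rule allI, simp only: const, simp)
qed

lemma card_affine_roots_le_1:
  fixes \<alpha> \<beta> c0 :: "'a :: field"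
  assumes "\<alpha> + \<beta> * c0 \<noteq> 0"
  shows "card {c. \<alpha> + \<beta> * c = 0} \<le> 1"
proof -
  have "x = y" if "\<alpha> + \<beta> * x = 0" "\<alpha> + \<beta> * y = 0" for x y
    using that assms by (metis add_left_cancel mult_cancel_left mult_zero_left)
  then have "{c. \<alpha> + \<beta> * c = 0} = {} \<or> (\<exists>x. {c. \<alpha> + \<beta> * c = 0} = {x})" by blast
  then show ?thesis by auto
qed

section \<open>Bases and coordinates modulo a subspace\<close>

context vec_space begin

text \<open>Independent sets have at most \<open>n\<close> elements, so a maximal one between
  \<open>T0\<close> and \<open>S\<close> exists; a vector of \<open>S\<close> outside its span could
  be added to it. It serves both to find a basis of a subspace and to extend that basis.\<close>

lemma maximal_lin_indpt_between:
  assumes "T0 \<subseteq> S" "S \<subseteq> carrier_vec n" "lin_indpt T0"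
  obtains T where "T0 \<subseteq> T" "T \<subseteq> S" "finite T" "card T \<le> n" "lin_indpt T" "S \<subseteq> span T"
proof -
  let ?P = "\<lambda>T. T0 \<subseteq> T \<and> T \<subseteq> S \<and> lin_indpt T"
  have bound: "finite T \<and> card T \<le> n" if "?P T" for T
    using that assms(2) li_le_dim[of T] dim_is_n by simp blast
  have "\<exists>T. finite T \<and> maximal T ?P"
    by (rule maximal_exists[of ?P n T0]) (use bound assms in blast)+
  then obtain T where T: "finite T" "maximal T ?P" by blast
  then have P: "?P T" and max: "\<And>T'. T \<subseteq> T' \<Longrightarrow> ?P T' \<Longrightarrow> T' = T"
    by (simp_all add: maximal_def)
  have TC: "T \<subseteq> carrier_vec n" using P assms by blast
  have "v \<in> span T" if v: "v \<in> S" for v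
  proof (cases "v \<in> T")
    case True
    then show ?thesis using in_own_span[of T] TC by auto
  next
    case False
    then have "\<not> ?P (T \<union> {v})" using max[of "T \<union> {v}"] by blast
    then have "lin_dep (T \<union> {v})" using P v by blast
    then show ?thesis
      using lin_dep_iff_in_span[of T v] P TC v False assms(2) by auto
  qed
  then show ?thesis using that[of T] P bound[OF P] by blast
qed

text \<open>This links span and independence in the ambient space with the dimension of
  \<open>U\<close> as a space of its own, which is how \<open>sub_dim\<close> is defined.\<close>

lemma subspace_basis:
  assumes U: "subspace class_ring U V"
  obtains \<beta> where "\<beta> \<subseteq> carrier_vec n" "finite \<beta>" "lin_indpt \<beta>" "span \<beta> = U" "card \<beta> = vectorspace.dim class_ring (V\<lparr>carrier := U\<rparr>)"
proof -
  have sm: "submodule class_ring U V" using U by (simp add: subspace_def)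
  then have UC: "U \<subseteq> carrier_vec n" using submodule.subset by fastforce
  interpret US: vectorspace class_ring "V\<lparr>carrier := U\<rparr>"
    using subspace_is_vs[OF U] .
  have li: "lin_indpt {}" by (auto simp: lin_dep_def)
  obtain \<beta> where \<beta>: "\<beta> \<subseteq> U" "finite \<beta>" "lin_indpt \<beta>" "U \<subseteq> span \<beta>"
    by (rule maximal_lin_indpt_between[of "{}" U, rotated 3]) (use UC li in auto)
  have "span \<beta> \<subseteq> U" using span_is_subset[OF \<beta>(1) sm] .
  with \<beta>(4) have span: "span \<beta> = U" by blast
  have "US.basis \<beta>"
    unfolding US.basis_def
    using span_li_not_depend[OF \<beta>(1) sm] \<beta> span by simp
  then have "card \<beta> = US.dim" using US.dim_basis \<beta>(2) by simp
  then show ?thesis using that[of \<beta>] \<beta> span UC by auto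
qed

text \<open>Extend a basis of \<open>U\<close> by rows of \<open>A\<close> to a basis of the sum of
  \<open>U\<close> and the row space. The \<open>k\<close> added rows form \<open>B\<close>, and
  \<open>W\<close> holds the coordinates of all rows of \<open>A\<close> along them, modulo
  \<open>U\<close>. Since the added rows are rows of \<open>A\<close> themselves, \<open>W\<close>
  has an identity block in the rows \<open>\<sigma> t\<close>.\<close>

lemma coordinates_modulo_subspace:
  assumes U: "subspace class_ring U V" and A: "A \<in> carrier_mat d n"
  obtains k W B \<sigma> where "k + vectorspace.dim class_ring (V\<lparr>carrier := U\<rparr>) \<le> n"
    "W \<in> carrier_mat d k" "B \<in> carrier_mat k n"
    "\<forall>y\<in>carrier_vec d. (A - W * B)\<^sup>T *\<^sub>v y \<in> U"
    "\<forall>t<k. \<sigma> t < d \<and> (\<forall>t'<k. W $$ (\<sigma> t, t') = (if t = t' then 1 else 0))"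
proof -
  have sm: "submodule class_ring U V" using U by (simp add: subspace_def)
  then have UC: "U \<subseteq> carrier_vec n" using submodule.subset by fastforce
  have rowsC: "set (rows A) \<subseteq> carrier_vec n" using A rows_carrier[of A] by auto
  obtain \<beta> where \<beta>: "\<beta> \<subseteq> carrier_vec n" "finite \<beta>" "lin_indpt \<beta>" "span \<beta> = U"
    "card \<beta> = vectorspace.dim class_ring (V\<lparr>carrier := U\<rparr>)"
    using subspace_basis[OF U] .
  obtain T where T: "\<beta> \<subseteq> T" "T \<subseteq> \<beta> \<union> set (rows A)" "finite T" "card T \<le> n"
    "\<beta> \<union> set (rows A) \<subseteq> span T"
    by (rule maximal_lin_indpt_between[of \<beta> "\<beta> \<union> set (rows A)"]) (use \<beta> rowsC in auto)
  define C where "C = T - \<beta>"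
  have C: "finite C" "C \<subseteq> set (rows A)" "T = \<beta> \<union> C" "\<beta> \<inter> C = {}" and CC: "C \<subseteq> carrier_vec n"
    using T rowsC by (auto simp: C_def)
  obtain cs where cs: "set cs = C" "distinct cs" using finite_distinct_list[OF C(1)] by blast
  define k where "k = length cs"
  have k: "k = card C" using cs distinct_card k_def by metis
  have csC: "cs ! t \<in> carrier_vec n" if "t < k" for t
    using that cs CC k_def nth_mem by blast
  \<comment> \<open>Prescribing unit coefficients for the vectors of \<open>C\<close> yields the
    identity block directly, with no appeal to uniqueness of coordinates.\<close>
  have "\<exists>a. (v \<in> C \<longrightarrow> a = (\<lambda>w. if w = v then 1 else 0)) \<and> v - lincomb a C \<in> U"
    if v: "v \<in> set (rows A)" for v
  proof (cases "v \<in> C")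
    case True
    let ?a = "\<lambda>w. if w = v then 1 else 0 :: 'a"
    have "lincomb ?a C = v"
    proof (rule eq_vecI)
      fix i assume "i < dim_vec v"
      then have "i < n" using v rowsC by auto
      then have "lincomb ?a C $ i = (\<Sum>w\<in>C. if w = v then w $ i else 0)"
        by (simp add: lincomb_index[OF _ CC] if_distrib[of "\<lambda>c. c * _"] cong: if_cong)
      then show "lincomb ?a C $ i = v $ i" using True C(1) by simp
    qed (use v rowsC lincomb_dim[OF C(1) CC] in auto)
    then have "v - lincomb ?a C = 0\<^sub>v n" using v rowsC by auto
    moreover have "0\<^sub>v n \<in> U" using submodule.zero_closed[OF sm] by simp
    ultimately show ?thesis using True by auto
  next
    case False
    have "v \<in> span T" using T v by auto
    then obtain a where a: "v = lincomb a T"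
      using finite_in_span[OF T(3), of v] T \<beta> CC C by auto
    have lb: "lincomb a \<beta> \<in> U" using \<beta> by auto
    have "v = lincomb a \<beta> + lincomb a C"
      using a lincomb_union[of \<beta> C a] C \<beta> CC by simp
    moreover have "lincomb a C \<in> carrier_vec n" "lincomb a \<beta> \<in> carrier_vec n"
      using carrier_vecI[OF lincomb_dim[OF C(1) CC, of a]] lb UC by auto
    ultimately have "v - lincomb a C = lincomb a \<beta>"
      by (intro eq_vecI) auto
    then show ?thesis using lb False by (intro exI[of _ a]) simp
  qed
  then obtain a where a1: "\<And>v. v \<in> C \<Longrightarrow> a v = (\<lambda>w. if w = v then 1 else 0)"
    and a2: "\<And>v. v \<in> set (rows A) \<Longrightarrow> v - lincomb (a v) C \<in> U"
    using C(2) by (metis subsetD)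
  define W where "W = mat d k (\<lambda>(s, t). a (row A s) (cs ! t))"
  define B where "B = mat_of_rows n cs"
  have W: "W \<in> carrier_mat d k" and B: "B \<in> carrier_mat k n"
    by (simp_all add: W_def B_def k_def)
  \<comment> \<open>Row \<open>s\<close> of \<open>W * B\<close> is the part of
    \<open>row A s\<close> along \<open>C\<close>; the remainder lies in \<open>U\<close>.\<close>
  have "row (A - W * B) s = row A s - lincomb (a (row A s)) C" if s: "s < d" for s
  proof (rule eq_vecI)
    fix j assume "j < dim_vec (row A s - lincomb (a (row A s)) C)"
    then have j: "j < n" using lincomb_dim[OF C(1) CC] by simp
    have "(W * B) $$ (s, j) = (\<Sum>t<k. a (row A s) (cs ! t) * cs ! t $ j)"
      using s j W B by (simp add: scalar_prod_def W_def B_def k_def mat_of_rows_index atLeast0LessThan)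
    also have "\<dots> = lincomb (a (row A s)) C $ j"
      using sum.reindex_bij_betw[OF bij_betw_nth[OF cs(2) refl cs(1)[symmetric]],
          of "\<lambda>w. a (row A s) w * w $ j"]
      by (simp add: lincomb_index[OF j CC] k_def atLeast0LessThan)
    finally show "row (A - W * B) s $ j = (row A s - lincomb (a (row A s)) C) $ j"
      using s j A W B lincomb_dim[OF C(1) CC] by simp
  qed (use s A B lincomb_dim[OF C(1) CC] in simp)
  then have Zrows: "set (rows (A - W * B)) \<subseteq> U"
    using a2 A W B unfolding rows_def set_map by auto
  have Zy: "(A - W * B)\<^sup>T *\<^sub>v y \<in> U" if y: "y \<in> carrier_vec d" for y
  proof -
    have Z: "A - W * B \<in> carrier_mat d n" using A W B by auto
    have "M\<^sup>T *\<^sub>v y \<in> row_space M" if "M \<in> carrier_mat d n" for M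
      using y that unfolding row_space_eq[OF that] by auto
    from this[OF Z] have "(A - W * B)\<^sup>T *\<^sub>v y \<in> row_space (A - W * B)" .
    also have "\<dots> \<subseteq> U" unfolding row_space_def using span_is_subset[OF Zrows sm] .
    finally show ?thesis .
  qed
  have "\<exists>s<d. row A s = cs ! t" if t: "t < k" for t
  proof -
    have "cs ! t \<in> set (rows A)" using t C cs k_def nth_mem by blast
    then show ?thesis using A by (auto simp: rows_def)
  qed
  then obtain \<sigma> where \<sigma>: "\<And>t. t < k \<Longrightarrow> \<sigma> t < d" "\<And>t. t < k \<Longrightarrow> row A (\<sigma> t) = cs ! t" by metis
  have W\<sigma>: "W $$ (\<sigma> t, t') = (if t = t' then 1 else 0)" if "t < k" "t' < k" for t t'
    using that \<sigma> cs a1[of "cs ! t"] nth_mem[of t cs] by (auto simp: W_def k_def nth_eq_iff_index_eq)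
  have "card T = card \<beta> + card C" using C \<beta> by (simp add: card_Un_disjoint)
  then have "k + vectorspace.dim class_ring (V\<lparr>carrier := U\<rparr>) \<le> n" using T(4) k \<beta>(5) by simp
  from that[OF this W B, of \<sigma>] show ?thesis using Zy \<sigma>(1) W\<sigma> by blast
qed

end

section \<open>Spanning modulo one side space through a nonzero minor\<close>

text \<open>The leading \<open>k\<close> rows of \<open>M\<close> form an invertible block, so the
  system is solved with its transpose and the solution padded by zeros to length
  \<open>N\<close>.\<close>

lemma transpose_mult_vec_surj:
  fixes M :: "'a :: field mat"
  assumes M: "M \<in> carrier_mat N k" and "k \<le> N"
    and det: "det (mat k k (\<lambda>(t, t'). M $$ (t, t'))) \<noteq> 0" and z: "z \<in> carrier_vec k"
  shows "\<exists>u\<in>carrier_vec N. M\<^sup>T *\<^sub>v u = z"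
proof -
  define A where "A = mat k k (\<lambda>(t, t'). M $$ (t, t'))"
  have A: "A \<in> carrier_mat k k" by (simp add: A_def)
  then have "det A\<^sup>T \<noteq> 0" using det det_transpose by (metis A_def)
  from det_non_zero_imp_unit[OF _ this, of k] A obtain C where
    C: "C \<in> carrier_mat k k" "A\<^sup>T * C = 1\<^sub>m k"
    by (auto simp: Units_def ring_mat_def)
  define w where "w = C *\<^sub>v z"
  have w: "w \<in> carrier_vec k" using C z by (simp add: w_def)
  have "A\<^sup>T *\<^sub>v w = (A\<^sup>T * C) *\<^sub>v z"
    unfolding w_def using A C z by (intro assoc_mult_mat_vec[symmetric]) auto
  then have Aw: "A\<^sup>T *\<^sub>v w = z" using C z by simp
  define u where "u = vec N (\<lambda>i. if i < k then w $ i else 0)"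
  have "M\<^sup>T *\<^sub>v u = A\<^sup>T *\<^sub>v w"
  proof (rule eq_vecI)
    fix j assume "j < dim_vec (A\<^sup>T *\<^sub>v w)"
    then have j: "j < k" using A by simp
    have "(M\<^sup>T *\<^sub>v u) $ j = (\<Sum>i<N. M $$ (i, j) * (if i < k then w $ i else 0))"
      using M j by (simp add: scalar_prod_def u_def atLeast0LessThan)
    also have "\<dots> = (\<Sum>i<k. M $$ (i, j) * w $ i)"
      using \<open>k \<le> N\<close> by (intro sum.mono_neutral_cong_right) auto
    also have "\<dots> = (A\<^sup>T *\<^sub>v w) $ j"
      using j w by (simp add: scalar_prod_def A_def atLeast0LessThan)
    finally show "(M\<^sup>T *\<^sub>v u) $ j = (A\<^sup>T *\<^sub>v w) $ j" .
  qed (use M A in simp)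
  then show ?thesis using Aw by (intro bexI[of _ u]) (auto simp: u_def)
qed

text \<open>The witness \<open>G x\<close> says that the leading \<open>k\<close> by
  \<open>k\<close> minor of \<open>mat N d x * W\<close> is nonzero. The existential hides
  \<open>k\<close> and \<open>W\<close>, which depend on \<open>U\<close>, and keeps only what the
  probability bound and the decoding need. The hypothesis on \<open>N\<close> makes room for the
  \<open>k\<close> rows.\<close>

lemma (in vec_space) ex_spanning_condition:
  assumes U: "subspace class_ring U V" and A: "A \<in> carrier_mat d n"
    and N: "n - vectorspace.dim class_ring (V\<lparr>carrier := U\<rparr>) \<le> N"
  shows "\<exists>G. (\<exists>x. (\<forall>j. j \<notin> {0..<N} \<times> {0..<d} \<longrightarrow> x j = 0) \<and> G x)
    \<and> (\<forall>x j. G x \<longrightarrow> card {c. \<not> G (x(j := c))} \<le> 1)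
    \<and> (\<forall>x. G x \<longrightarrow> (\<forall>r\<in>row_space A. \<exists>u\<in>carrier_vec N. r - (mat N d x * A)\<^sup>T *\<^sub>v u \<in> U))"
proof -
  obtain k W B \<sigma> where k: "k + vectorspace.dim class_ring (V\<lparr>carrier := U\<rparr>) \<le> n"
    and W: "W \<in> carrier_mat d k" and B: "B \<in> carrier_mat k n"
    and Z: "\<forall>y\<in>carrier_vec d. (A - W * B)\<^sup>T *\<^sub>v y \<in> U"
    and \<sigma>: "\<forall>t<k. \<sigma> t < d \<and> (\<forall>t'<k. W $$ (\<sigma> t, t') = (if t = t' then 1 else 0))"
    using coordinates_modulo_subspace[OF U A] .
  have kN: "k \<le> N" using k N by linarith
  define D where "D x = det (mat k k (\<lambda>(t, t'). \<Sum>s<d. x (t, s) * W $$ (s, t')))" for x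
  have "\<exists>x. (\<forall>j. j \<notin> {0..<N} \<times> {0..<d} \<longrightarrow> x j = 0) \<and> D x \<noteq> 0"
  proof (intro exI conjI)
    \<comment> \<open>Row \<open>t\<close> of this matrix selects row \<open>\<sigma> t\<close> of
      \<open>W\<close>, so the minor is that of the identity.\<close>
    let ?x = "\<lambda>(t, s). if t < k \<and> s = \<sigma> t then 1 else 0 :: 'a"
    show "\<forall>j. j \<notin> {0..<N} \<times> {0..<d} \<longrightarrow> ?x j = 0" using kN \<sigma> by auto
    have "mat k k (\<lambda>(t, t'). \<Sum>s<d. ?x (t, s) * W $$ (s, t')) = 1\<^sub>m k"
    proof (rule eq_matI)
      fix t t' assume t: "t < dim_row (1\<^sub>m k :: 'a mat)" "t' < dim_col (1\<^sub>m k :: 'a mat)"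
      then have "(\<Sum>s<d. ?x (t, s) * W $$ (s, t')) = (\<Sum>s<d. if s = \<sigma> t then W $$ (s, t') else 0)"
        by (intro sum.cong) auto
      then show "mat k k (\<lambda>(t, t'). \<Sum>s<d. ?x (t, s) * W $$ (s, t')) $$ (t, t') = 1\<^sub>m k $$ (t, t')"
        using t \<sigma> by simp
    qed auto
    then show "D ?x \<noteq> 0" by (simp add: D_def)
  qed
  moreover have "card {c. \<not> D (x(j := c)) \<noteq> 0} \<le> 1" if "D x \<noteq> 0" for x j
  proof -
    obtain r s where j: "j = (r, s)" by fastforce
    obtain \<alpha> \<beta> where ab: "\<And>c. D (x(j := c)) = \<alpha> + \<beta> * c"
      using det_update_entry_affine[where k = k and d = d and x = x and r = r and l = s and W = W] unfolding D_def j by blast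
    \<comment> \<open>Writing \<open>x j\<close> back at \<open>j\<close> does not change
      \<open>x\<close>, so the affine function has a nonzero value.\<close>
    have "\<alpha> + \<beta> * x j \<noteq> 0" using ab[of "x j"] that by simp
    then show ?thesis unfolding ab not_not by (rule card_affine_roots_le_1)
  qed
  moreover have "\<exists>u\<in>carrier_vec N. r - (mat N d x * A)\<^sup>T *\<^sub>v u \<in> U"
    if x: "D x \<noteq> 0" and r: "r \<in> row_space A" for x r
  proof -
    define L where "L = mat N d x"
    have L: "L \<in> carrier_mat N d" by (simp add: L_def)
    obtain y where y: "y \<in> carrier_vec d" "r = A\<^sup>T *\<^sub>v y"
      using r A unfolding row_space_eq[OF A] by auto
    have "mat k k (\<lambda>(t, t'). (L * W) $$ (t, t')) = mat k k (\<lambda>(t, t'). \<Sum>s<d. x (t, s) * W $$ (s, t'))"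
      using kN W by (intro eq_matI) (auto simp: L_def scalar_prod_def atLeast0LessThan)
    then have "det (mat k k (\<lambda>(t, t'). (L * W) $$ (t, t'))) \<noteq> 0" using x by (simp add: D_def)
    \<comment> \<open>The vector \<open>W\<^sup>T *\<^sub>v y\<close> consists of the coordinates of
      \<open>r\<close> modulo \<open>U\<close>; \<open>u\<close> combines the rows of
      \<open>L * A\<close> to a vector with the same coordinates.\<close>
    from transpose_mult_vec_surj[OF _ kN this, of "W\<^sup>T *\<^sub>v y"] L W y
    obtain u where u: "u \<in> carrier_vec N" "(L * W)\<^sup>T *\<^sub>v u = W\<^sup>T *\<^sub>v y" by auto
    define v where "v = L\<^sup>T *\<^sub>v u"
    have v: "v \<in> carrier_vec d" using L u by (simp add: v_def)
    have Wv: "W\<^sup>T *\<^sub>v v = W\<^sup>T *\<^sub>v y"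
      using u L W unfolding v_def by (simp add: transpose_mult[OF L W] assoc_mult_mat_vec[of _ k d _ N])
    have "r - (L * A)\<^sup>T *\<^sub>v u = A\<^sup>T *\<^sub>v y - A\<^sup>T *\<^sub>v v"
      using u L A unfolding v_def y by (simp add: transpose_mult[OF L A] assoc_mult_mat_vec[of _ n d _ N])
    also have "\<dots> = A\<^sup>T *\<^sub>v (y - v)"
      using A y v by (intro mult_minus_distrib_mat_vec[symmetric]) auto
    \<comment> \<open>\<open>W\<^sup>T\<close> annihilates \<open>y - v\<close>, so subtracting
      \<open>W * B\<close> changes nothing and leaves a combination of rows that lies in
      \<open>U\<close>.\<close>
    also have "\<dots> = (A - W * B)\<^sup>T *\<^sub>v (y - v)"
    proof -
      have "(W * B)\<^sup>T *\<^sub>v (y - v) = B\<^sup>T *\<^sub>v (W\<^sup>T *\<^sub>v (y - v))"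
        using W B y v by (simp add: transpose_mult[OF W B] assoc_mult_mat_vec[of _ n k _ d])
      also have "W\<^sup>T *\<^sub>v (y - v) = 0\<^sub>v k"
        using Wv W y v by (subst mult_minus_distrib_mat_vec[of _ k d]) auto
      also have "B\<^sup>T *\<^sub>v 0\<^sub>v k = 0\<^sub>v n" using B by auto
      finally have WB0: "(W * B)\<^sup>T *\<^sub>v (y - v) = 0\<^sub>v n" .
      have WB: "W * B \<in> carrier_mat d n" using W B by simp
      have "(A - W * B)\<^sup>T *\<^sub>v (y - v) = A\<^sup>T *\<^sub>v (y - v) - (W * B)\<^sup>T *\<^sub>v (y - v)"
        using A WB y v
        by (simp only: transpose_minus[OF A WB]) (intro minus_mult_distrib_mat_vec, auto)
      also have "\<dots> = A\<^sup>T *\<^sub>v (y - v)"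
        unfolding WB0 using A y v by (intro eq_vecI) auto
      finally show ?thesis ..
    qed
    finally have "r - (L * A)\<^sup>T *\<^sub>v u \<in> U" using Z y v by simp
    then show ?thesis using u(1) L_def by blast
  qed
  ultimately show ?thesis by (intro exI[of _ "\<lambda>x. D x \<noteq> 0"]) blast
qed

section \<open>Linear index codes and the probability bound\<close>

text \<open>If the requested row is a combination \<open>u\<close> of the rows of
  \<open>L * VS\<close> plus a combination \<open>w\<close> of the rows of \<open>V i\<close>, then
  applying the same combinations to the received matrix and to the side information recovers the
  request.\<close>

lemma linear_code_decodes:
  fixes I :: "'a :: {field, finite} iccsi"
  assumes I: "iccsi_instance I"
    and VS: "generates (msgs I) VS (sender I)"
    and V: "\<And>i. i < users I \<Longrightarrow> generates (msgs I) (V i) (side I i)"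
    and L: "L \<in> carrier_mat N (d_sender I)"
    and dec: "\<And>i. i < users I \<Longrightarrow> \<exists>u\<in>carrier_vec N. row (request I) i - (L * VS)\<^sup>T *\<^sub>v u \<in> side I i"
  shows "represents_linear_IC I VS V N L"
proof -
  define E where "E X = L * VS * X" for X
  have VSc: "VS \<in> carrier_mat (d_sender I) (msgs I)"
    using VS by (simp add: generates_def d_sender_def)
  have R: "request I \<in> carrier_mat (users I) (msgs I)" using I by (simp add: iccsi_instance_def)
  have LV: "L * VS \<in> carrier_mat N (msgs I)" using L VSc by simp
  have "\<exists>D \<in> carrier_mat N (blk I) \<times> carrier_mat (d_side I i) (blk I) \<rightarrow> carrier_vec (blk I).
          \<forall>X \<in> carrier_mat (msgs I) (blk I). D (E X, V i * X) = row (request I * X) i"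
    if i: "i < users I" for i
  proof -
    have Vi: "V i \<in> carrier_mat (d_side I i) (msgs I)"
      and side: "side I i = vec_space.row_space (msgs I) (V i)"
      using V[OF i] by (auto simp: generates_def d_side_def)
    obtain u where u: "u \<in> carrier_vec N" "row (request I) i - (L * VS)\<^sup>T *\<^sub>v u \<in> side I i"
      using dec[OF i] by blast
    then obtain w where w: "w \<in> carrier_vec (d_side I i)"
      "row (request I) i - (L * VS)\<^sup>T *\<^sub>v u = (V i)\<^sup>T *\<^sub>v w"
      using Vi unfolding side vec_space.row_space_eq[OF Vi] by auto
    have c: "row (request I) i \<in> carrier_vec (msgs I)" "(L * VS)\<^sup>T *\<^sub>v u \<in> carrier_vec (msgs I)"
      "(V i)\<^sup>T *\<^sub>v w \<in> carrier_vec (msgs I)"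
      using row_carrier_vec[OF i R] LV u(1) Vi w(1) by simp_all
    have "a = b + (a - b)" if "a \<in> carrier_vec k" "b \<in> carrier_vec k" for a b :: "'a vec" and k
      using that by (intro eq_vecI) auto
    from this[OF c(1,2)]
    have "row (request I) i = (L * VS)\<^sup>T *\<^sub>v u + (row (request I) i - (L * VS)\<^sup>T *\<^sub>v u)" .
    then have r: "row (request I) i = (L * VS)\<^sup>T *\<^sub>v u + (V i)\<^sup>T *\<^sub>v w"
      unfolding w(2) .
    define D where "D = (\<lambda>(Y :: 'a mat, Z :: 'a mat). Y\<^sup>T *\<^sub>v u + Z\<^sup>T *\<^sub>v w)"
    have "D (E X, V i * X) = row (request I * X) i" if X: "X \<in> carrier_mat (msgs I) (blk I)" for X
    proof -
      have "row (request I * X) i = X\<^sup>T *\<^sub>v row (request I) i"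
        using R X i by (intro eq_vecI) (auto intro!: comm_scalar_prod[of _ "msgs I"])
      also have "\<dots> = X\<^sup>T *\<^sub>v ((L * VS)\<^sup>T *\<^sub>v u) + X\<^sup>T *\<^sub>v ((V i)\<^sup>T *\<^sub>v w)"
        unfolding r using X c by (intro mult_add_distrib_mat_vec) auto
      also have "X\<^sup>T *\<^sub>v ((L * VS)\<^sup>T *\<^sub>v u) = (E X)\<^sup>T *\<^sub>v u"
        unfolding E_def transpose_mult[OF LV X]
        using X LV u by (intro assoc_mult_mat_vec[symmetric]) auto
      also have "X\<^sup>T *\<^sub>v ((V i)\<^sup>T *\<^sub>v w) = (V i * X)\<^sup>T *\<^sub>v w"
        unfolding transpose_mult[OF Vi X]
        using X Vi w by (intro assoc_mult_mat_vec[symmetric]) auto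
      finally show ?thesis by (simp add: D_def)
    qed
    moreover have "D \<in> carrier_mat N (blk I) \<times> carrier_mat (d_side I i) (blk I) \<rightarrow> carrier_vec (blk I)"
      using u w by (auto simp: D_def intro!: add_carrier_vec)
    ultimately show ?thesis by blast
  qed
  moreover have "E \<in> carrier_mat (msgs I) (blk I) \<rightarrow> carrier_mat N (blk I)"
    using LV by (auto simp: E_def)
  ultimately show ?thesis
    using L unfolding represents_linear_IC_def is_IC_def represents_def E_def by blast
qed

theorem mainTheorem3:
  fixes I :: "'a :: {field, finite} iccsi"
    and VS :: "'a mat" and V :: "nat \<Rightarrow> 'a mat"
    and N m' q :: nat
  assumes "iccsi_instance I"
    and "generates (msgs I) VS (sender I)"
    and "\<And>i. i < users I \<Longrightarrow> generates (msgs I) (V i) (side I i)"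
    and "N = max_codim I"
    and "m' = num_side_classes I"
    and "q = CARD('a)"
    and "q > m'"
  shows "measure_pmf.prob (random_mat N (d_sender I)) {L. represents_linear_IC I VS V N L}
           \<ge> (1 - real m' / real q) ^ (N * d_sender I)"
proof -
  \<comment> \<open>Conditions are indexed by side spaces instead of users, which is why
    \<open>m'\<close> and not the number of users enters the bound.\<close>
  define K where "K = side I ` {0..<users I}"
  define d where "d = d_sender I"
  define J where "J = {0..<N} \<times> {0..<d}"
  have VS: "VS \<in> carrier_mat d (msgs I)" and sender: "sender I = vec_space.row_space (msgs I) VS"
    using assms(2) by (auto simp: generates_def d_def d_sender_def)
  have "side_equiv I = {(i, j). i \<in> {0..<users I} \<and> j \<in> {0..<users I} \<and> side I i = side I j}"
    by (auto simp: side_equiv_def)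
  then have m': "m' = card K"
    using card_quotient_kernel[of "{0..<users I}" "side I"] by (simp add: assms(5) num_side_classes_def K_def)
  define P where "P G U \<longleftrightarrow> (\<exists>x. (\<forall>j. j \<notin> J \<longrightarrow> x j = 0) \<and> G x)
    \<and> (\<forall>x j. G x \<longrightarrow> card {c. \<not> G (x(j := c))} \<le> 1)
    \<and> (\<forall>x. G x \<longrightarrow> (\<forall>r\<in>sender I. \<exists>u\<in>carrier_vec N. r - (mat N d x * VS)\<^sup>T *\<^sub>v u \<in> U))"
    for G :: "(nat \<times> nat \<Rightarrow> 'a) \<Rightarrow> bool" and U
  have "\<exists>G. P G U" if "U \<in> K" for U
  proof -
    from that obtain i where i: "i < users I" "U = side I i" by (auto simp: K_def)
    have U: "sub_space (msgs I) U" using assms(1) i by (simp add: iccsi_instance_def)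
    have "msgs I - sub_dim (msgs I) U \<le> N"
      unfolding assms(4) max_codim_def using i by (intro Max_ge) (auto simp: d_side_def)
    then show ?thesis
      unfolding P_def J_def sender sub_dim_def
      by (rule vec_space.ex_spanning_condition[OF U VS])
  qed
  then have "\<exists>G. \<forall>U\<in>K. P (G U) U" by (intro bchoice ballI)
  then obtain G where G: "\<And>U. U \<in> K \<Longrightarrow> P (G U) U" by blast
  \<comment> \<open>The condition for a side space covers all vectors of \<open>sender I\<close>,
    hence the requests of all users sharing that space.\<close>
  have "represents_linear_IC I VS V N (mat N d x)" if "\<forall>U\<in>K. G U x" for x
  proof (rule linear_code_decodes[OF assms(1-3)])
    fix i assume i: "i < users I"
    then have "row (request I) i \<in> sender I" using assms(1) by (simp add: iccsi_instance_def)
    then show "\<exists>u\<in>carrier_vec N. row (request I) i - (mat N d x * VS)\<^sup>T *\<^sub>v u \<in> side I i"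
      using G[of "side I i"] that i unfolding P_def K_def by simp
  qed (simp_all add: d_def)
  then have sub: "{x. \<forall>U\<in>K. G U x} \<subseteq> mat N d -` {L. represents_linear_IC I VS V N L}" by auto
  have "(1 - real m' / real q) ^ (N * d) = (1 - real (card K) / real CARD('a)) ^ card J"
    by (simp add: m' assms(6) J_def)
  also have "\<dots> \<le> measure_pmf.prob (Pi_pmf J 0 (\<lambda>_. pmf_of_set (UNIV :: 'a set))) {x. \<forall>U\<in>K. G U x}"
  proof (rule prob_Pi_pmf_uniform_ge)
    show "finite J" "finite K" "card K \<le> CARD('a)"
      using assms(6,7) m' by (simp_all add: J_def K_def)
    show "\<exists>x. (\<forall>j. j \<notin> J \<longrightarrow> x j = 0) \<and> G U x" if "U \<in> K" for U
      using G[OF that] unfolding P_def by blast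
    show "card {c. \<not> G U (x(j := c))} \<le> 1" if "U \<in> K" "G U x" for U x j
      using G[OF that(1)] that(2) unfolding P_def by blast
  qed
  also have "\<dots> \<le> measure_pmf.prob (random_mat N d) {L. represents_linear_IC I VS V N L}"
    unfolding random_mat_def measure_map_pmf J_def[symmetric]
    by (rule measure_pmf.finite_measure_mono[OF sub]) simp
  finally show ?thesis by (simp add: d_def)
qed

end
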